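(* Let $O$ and $O_0$ be a pair of open subsets in $\mathbb{R}^d$, let $v\in\mathrm{sbh}(O)$ and $g\in\mathrm{sbh}(O_0)$ be a pair of functions, and let $m_v,M_v,m_g,M_g$ be real numbers such that $$-\infty<m_v\le \inf_{x\in O\cap\partial O_0} v(x),$$ $$\sup_{x\in O_0\cap\partial O}\ \limsup_{\substack{y\to x\\ y\in O_0\cap O}} v(y)\le M_v<+\infty,$$ $$-\infty<\sup_{x\in O\cap\partial O_0}\ \limsup_{\substack{y\to x\\ y\in O\cap O_0}} g(y)\le m_g<M_g\le \inf_{x\in O_0\cap\partial O} g(x)<+\infty .$$ If we choose the function $$v_0:=\frac{M_v^++m_v^-}{M_g-m_g}\,(2g-M_g-m_g)\in\mathrm{sbh}(O_0),$$ then the function $$V:=\begin{cases} v_0 & \text{on } O_0\setminus O,\\ \sup\{v_0,v\} & \text{on } O_0\cap O,\\ v & \text{on } O\setminus O_0,\end{cases}$$ is subharmonic on $O_0\cup O$.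
   Context: Here $d\in\mathbb{N}=\{1,2,\dots\}$. For an open set $O\subset\mathbb{R}^d$, $\mathrm{sbh}(O)$ denotes the class of all subharmonic functions on $O$ (locally convex functions if $d=1$), with values in $\mathbb{R}\cup\{-\infty\}$; the function identically equal to $-\infty$ is regarded as subharmonic. Boundaries $\partial$ are taken in the one-point compactification $\mathbb{R}^d_\infty=\mathbb{R}^d\cup\{\infty\}$ of $\mathbb{R}^d$. For $x\in\mathbb{R}\cup\{\pm\infty\}$, $x^+:=\max\{0,x\}$ and $x^-:=(-x)^+$. Convention: $0\cdot(\pm\infty):=0$. *)

theory Defs
  imports "HOL-Analysis.Analysis"
begin

text \<open>
  Functions on a subset S of the space are represented by total functions into
  \<^typ>\<open>ereal\<close>; only their values on S matter below.
\<close>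

definition usc_on :: "'a::topological_space set \<Rightarrow> ('a \<Rightarrow> ereal) \<Rightarrow> bool" where
  "usc_on S u \<longleftrightarrow> (\<forall>x\<in>S. Limsup (at x within S) u \<le> u x)"

text \<open>
  The normalised surface measure on \<^term>\<open>sphere x r\<close>: the unit ball with its uniform distribution
  is projected radially onto the unit sphere (recall that \<^term>\<open>sgn z\<close> is \<open>z / |z|\<close>),
  which yields the rotation-invariant probability measure there, and the result is moved to
  \<^term>\<open>sphere x r\<close>. The origin, where \<^term>\<open>sgn\<close> vanishes, is a null set.
\<close>

definition sphere_prob :: "'a::euclidean_space \<Rightarrow> real \<Rightarrow> 'a measure" where
  "sphere_prob x r = distr (uniform_measure lborel (cball 0 1)) borel (\<lambda>z. x + r *\<^sub>R sgn z)"

text \<open>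
  The integral is the integral of the positive part minus that of the negative part
  (\<^term>\<open>e2ennreal\<close> sends negative values to 0). For a function that is upper semicontinuous and
  nowhere \<open>\<infinity>\<close> on the sphere the first integral is finite, so the mean is a real number or
  \<open>-\<infinity>\<close>, and the difference \<open>\<infinity> - \<infinity>\<close> does not occur.
\<close>

definition sphere_mean :: "('a::euclidean_space \<Rightarrow> ereal) \<Rightarrow> 'a \<Rightarrow> real \<Rightarrow> ereal" where
  "sphere_mean u x r =
     enn2ereal (\<integral>\<^sup>+y\<in>sphere x r. e2ennreal (u y) \<partial>sphere_prob x r)
     - enn2ereal (\<integral>\<^sup>+y\<in>sphere x r. e2ennreal (- u y) \<partial>sphere_prob x r)"

definition locally_submean_on :: "'a::euclidean_space set \<Rightarrow> ('a \<Rightarrow> ereal) \<Rightarrow> bool" where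
  "locally_submean_on S u \<longleftrightarrow>
     (\<forall>x\<in>S. \<exists>\<rho>>0. ball x \<rho> \<subseteq> S \<and> (\<forall>r. 0 < r \<and> r < \<rho> \<longrightarrow> u x \<le> sphere_mean u x r))"

text \<open>\<^const>\<open>convex_on\<close> is for real-valued functions; here the value \<open>-\<infinity>\<close> is allowed.\<close>

definition locally_convex_on :: "'a::euclidean_space set \<Rightarrow> ('a \<Rightarrow> ereal) \<Rightarrow> bool" where
  "locally_convex_on S u \<longleftrightarrow>
     (\<forall>x\<in>S. \<exists>\<rho>>0. ball x \<rho> \<subseteq> S \<and>
        (\<forall>y\<in>ball x \<rho>. \<forall>z\<in>ball x \<rho>. \<forall>t\<in>{0..1}.
           u ((1 - t) *\<^sub>R y + t *\<^sub>R z) \<le> ereal (1 - t) * u y + ereal t * u z))"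

text \<open>
  The class sbh(S), for open S. As usual with this definition, a function
  that is identically \<open>-\<infinity>\<close> (on S, or on some components of S) is subharmonic.
\<close>

definition subharmonic_on :: "'a::euclidean_space set \<Rightarrow> ('a \<Rightarrow> ereal) \<Rightarrow> bool" where
  "subharmonic_on S u \<longleftrightarrow>
     (\<forall>x\<in>S. u x \<noteq> \<infinity>) \<and>
     (if DIM('a) = 1 then locally_convex_on S u else usc_on S u \<and> locally_submean_on S u)"

text \<open>
  Finite points belong to the boundary of a set in the one-point compactification iff they belong
  to its ordinary boundary. Hence, in intersections with subsets of the space itself,
  the boundary in the compactification may be replaced by \<^const>\<open>frontier\<close>.
\<close>

lemma frontier_of_one_point_compactification:
  fixes S T :: "'a::euclidean_space set"
  shows "Some ` S \<inter> (Alexandroff_compactification euclidean) frontier_of (Some ` T)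
         = Some ` (S \<inter> frontier T)"
proof -
  let ?X = "Alexandroff_compactification (euclidean :: 'a topology)"
  have cl: "Some x \<in> ?X closure_of B \<longleftrightarrow> x \<in> closure (Some -` B)"
    if B: "B \<subseteq> topspace ?X" for x :: 'a and B
  proof
    assume L: "Some x \<in> ?X closure_of B"
    have "\<exists>y\<in>Some -` B. y \<in> W" if "x \<in> W" "open W" for W
    proof -
      have "openin ?X (Some ` W)" using that(2) by simp
      moreover have "Some x \<in> Some ` W" using that(1) by simp
      ultimately obtain y where "y \<in> B" "y \<in> Some ` W"
        using L unfolding in_closure_of by metis
      then show ?thesis by auto
    qed
    then show "x \<in> closure (Some -` B)"
      unfolding closure_iff_nhds_not_empty by (metis disjoint_iff subset_iff)
  next
    assume R: "x \<in> closure (Some -` B)"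
    show "Some x \<in> ?X closure_of B"
      unfolding in_closure_of
    proof (intro conjI allI impI)
      fix W assume W: "Some x \<in> W \<and> openin ?X W"
      then have "open (Some -` W :: 'a set)"
        using openin_continuous_map_preimage [OF continuous_map_Some, of euclidean W]
        by (simp add: vimage_def)
      then have "Some -` B \<inter> Some -` W \<noteq> {}"
        using R W unfolding closure_iff_nhds_not_empty by blast
      then show "\<exists>y. y \<in> B \<and> y \<in> W" by auto
    qed simp
  qed
  have "Some -` (Some ` T) = T" "Some -` (topspace ?X - Some ` T) = - T"
    by auto
  then have "Some x \<in> ?X frontier_of (Some ` T) \<longleftrightarrow> x \<in> frontier T" for x :: 'a
    using cl [of "Some ` T" x] cl [of "topspace ?X - Some ` T" x]
    unfolding frontier_of_closures frontier_closures by auto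
  then show ?thesis by auto
qed

end

theory Submission
  imports Defs "HOL-Probability.Probability_Measure"
begin

text \<open>
  The factor in \<open>v0\<close> is chosen so that \<open>v0\<close> takes the value \<open>k = M\<^sub>v\<^sup>+ + m\<^sub>v\<^sup>-\<close> where
  \<open>g = M\<^sub>g\<close>, and the value \<open>- k\<close> where \<open>g = m\<^sub>g\<close>. As \<open>M\<^sub>v \<le> k\<close> and \<open>- k \<le> m\<^sub>v\<close>,
  the function \<open>v0\<close> dominates the upper limits of \<open>v\<close> on the part of the boundary of \<open>U\<close> that lies
  in \<open>U0\<close>, while \<open>v\<close> dominates the upper limits of \<open>v0\<close> on the part of the boundary of \<open>U0\<close> that
  lies in \<open>U\<close>. These two conditions are symmetric in the two functions, and \<open>subharmonic_on_glue\<close>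
  shows that they suffice for gluing. They are what upper semicontinuity requires: a point of
  \<open>U0 - U\<close> may be approached from inside \<open>U\<close>, where the competitor \<open>v\<close> enters the
  supremum, and its upper limit must not exceed \<open>v0\<close>. The sub-mean-value inequality is then
  immediate, because at each point the glued function equals one of the two given functions, say
  \<open>w\<close>, which is subharmonic near the point and lies below the glued function there, so
  that the inequality for \<open>w\<close> passes to the glued function by monotonicity of the mean.

  In dimension one subharmonicity is defined by local convexity, which does not obviously survive
  gluing. It is therefore reduced to the same shape: by \<open>subharmonic_on_iff_mean\<close>, in every
  dimension subharmonic functions are the upper semicontinuous functions without the value \<open>\<infinity>\<close>
  that satisfy a local sub-mean-value inequality for some monotone mean. In dimension one this is
  the mean over the two endpoints of a chord, and the nontrivial half is that upper semicontinuity
  and the local midpoint inequality give convexity (\<open>chord_submean_imp_convex\<close>, by a maximum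
  principle).

  The other ingredient is that a nonnegative multiple of a subharmonic function plus a constant
  is subharmonic (\<open>subharmonic_on_affine\<close>). For spherical means this needs the
  measurability of upper semicontinuous functions, and some care with infinite integrals.
\<close>

section \<open>Upper semicontinuity\<close>

lemma Limsup_le_ereal_iff:
  fixes f :: "'a \<Rightarrow> ereal"
  shows "Limsup F f \<le> t \<longleftrightarrow> (\<forall>a. t < ereal a \<longrightarrow> (\<forall>\<^sub>F y in F. f y < ereal a))"
proof
  assume R: "\<forall>a. t < ereal a \<longrightarrow> (\<forall>\<^sub>F y in F. f y < ereal a)"
  show "Limsup F f \<le> t"
    unfolding Limsup_le_iff
  proof (intro allI impI)
    fix b assume "t < b"
    then obtain a where a: "t < ereal a" "ereal a < b"
      using ereal_dense2 by blast
    have "\<forall>\<^sub>F y in F. f y < ereal a"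
      using R a(1) by blast
    then show "\<forall>\<^sub>F y in F. f y < b"
      by eventually_elim (use a(2) in auto)
  qed
qed (auto simp: Limsup_le_iff)

lemma usc_on_eventually:
  assumes "usc_on S u" "x \<in> S" "u x < a"
  shows "\<forall>\<^sub>F y in nhds x. y \<in> S \<longrightarrow> u y < a"
proof -
  have "\<forall>\<^sub>F y in at x within S. u y < a"
    using assms unfolding usc_on_def Limsup_le_iff by blast
  then have "\<forall>\<^sub>F y in nhds x. y \<noteq> x \<longrightarrow> y \<in> S \<longrightarrow> u y < a"
    by (simp add: eventually_at_filter)
  then show ?thesis
    by eventually_elim (use assms in auto)
qed

lemma usc_on_open_iff:
  fixes u :: "'a::topological_space \<Rightarrow> ereal"
  assumes "open S"
  shows "usc_on S u \<longleftrightarrow> (\<forall>x\<in>S. \<forall>a>u x. \<forall>\<^sub>F y in nhds x. u y < a)"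
proof -
  have "Limsup (at x within S) u \<le> u x \<longleftrightarrow> (\<forall>a>u x. \<forall>\<^sub>F y in nhds x. u y < a)" if "x \<in> S" for x
    unfolding Limsup_le_iff at_within_open[OF that assms] eventually_nhds_conv_at by auto
  then show ?thesis
    unfolding usc_on_def by simp
qed

text \<open>
  If no value were the largest, then the open sets on which \<open>u\<close> stays below one of its values
  \<open>u (q x)\<close> would cover \<open>K\<close>; a finite subcover bounds \<open>u\<close> strictly by the largest of
  finitely many of its own values.
\<close>
lemma usc_attains_sup:
  fixes u :: "'a::topological_space \<Rightarrow> ereal"
  assumes K: "compact K" "K \<noteq> {}" and u: "usc_on K u"
  shows "\<exists>m\<in>K. \<forall>x\<in>K. u x \<le> u m"
proof (rule ccontr)
  assume "\<not> ?thesis"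
  then have "\<forall>x\<in>K. \<exists>y\<in>K. u x < u y"
    by (auto simp: not_le)
  then obtain q where q: "\<And>x. x \<in> K \<Longrightarrow> q x \<in> K \<and> u x < u (q x)"
    by metis
  have "\<exists>W. open W \<and> x \<in> W \<and> (\<forall>y\<in>W. y \<in> K \<longrightarrow> u y < u (q x))" if "x \<in> K" for x
    using usc_on_eventually[OF u that conjunct2[OF q[OF that]]] by (simp add: eventually_nhds)
  then obtain W where W:
    "\<And>x. x \<in> K \<Longrightarrow> open (W x) \<and> x \<in> W x \<and> (\<forall>y\<in>W x. y \<in> K \<longrightarrow> u y < u (q x))"
    by metis
  obtain C where C: "C \<subseteq> K" "finite C" "K \<subseteq> (\<Union>x\<in>C. W x)"
    by (rule compactE_image[OF K(1), of K W]) (use W in auto)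
  with K have "C \<noteq> {}" by auto
  then obtain c where c: "c \<in> C" "\<And>x. x \<in> C \<Longrightarrow> u (q x) \<le> u (q c)"
    using C(2) Max_in[of "(u \<circ> q) ` C"] Max_ge[of "(u \<circ> q) ` C"] by fastforce
  then have "q c \<in> K" using C q by auto
  then obtain x where "x \<in> C" "q c \<in> W x" using C by auto
  then have "u (q c) < u (q x)" using W C \<open>q c \<in> K\<close> by auto
  with c \<open>x \<in> C\<close> show False by (auto simp: not_le[symmetric])
qed

lemma usc_compact_superlevel:
  fixes u :: "'a::topological_space \<Rightarrow> ereal"
  assumes K: "compact K" "closed K" and u: "usc_on K u"
  shows "compact {x\<in>K. c \<le> u x}"
proof -
  let ?Z = "{x\<in>K. c \<le> u x}"
  have "open (- ?Z)"
  proof (subst open_subopen, intro ballI)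
    fix x assume x: "x \<in> - ?Z"
    have "\<forall>\<^sub>F y in nhds x. y \<in> - ?Z"
    proof (cases "x \<in> K")
      case True
      with x have "u x < c" by (auto simp: not_le)
      from usc_on_eventually[OF u True this] show ?thesis
        by eventually_elim auto
    next
      case False
      then have "\<forall>\<^sub>F y in nhds x. y \<in> - K"
        using K by (intro eventually_nhds_in_open) auto
      then show ?thesis
        by eventually_elim auto
    qed
    then obtain T where "open T" "x \<in> T" "\<forall>y\<in>T. y \<in> - ?Z"
      unfolding eventually_nhds by blast
    then show "\<exists>T. open T \<and> x \<in> T \<and> T \<subseteq> - ?Z"
      by (intro exI[of _ T] conjI subsetI) simp_all
  qed
  then have "closed ?Z"
    by (simp only: closed_def)
  then have "compact (K \<inter> ?Z)"
    using K by (intro compact_Int_closed)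
  moreover have "K \<inter> ?Z = ?Z" by auto
  ultimately show ?thesis by simp
qed

lemma usc_on_borel:
  fixes u :: "'a::topological_space \<Rightarrow> ereal"
  assumes S: "open S" and u: "usc_on S u" and K: "K \<in> sets borel" "K \<subseteq> S"
  shows "(\<lambda>x. if x \<in> K then u x else 0) \<in> borel_measurable borel"
proof (rule borel_measurableI_less)
  fix a
  have "\<forall>\<^sub>F y in nhds x. y \<in> S \<and> u y < a" if "x \<in> S" "u x < a" for x
    using u that S unfolding usc_on_open_iff[OF S] by (auto intro: eventually_conj eventually_nhds_in_open)
  then have "open {x\<in>S. u x < a}"
    by (subst open_subopen) (fastforce simp: eventually_nhds)
  moreover have "{x\<in>space borel. (if x \<in> K then u x else 0) < a}
      = ({x\<in>S. u x < a} \<inter> K) \<union> (if 0 < a then - K else {})"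
    using K by auto
  ultimately show "{x\<in>space borel. (if x \<in> K then u x else 0) < a} \<in> sets borel"
    using K by (auto simp del: space_borel)
qed

lemma Limsup_affine_le:
  fixes f :: "'a \<Rightarrow> ereal"
  assumes "Limsup F f \<le> t" "0 \<le> a"
  shows "Limsup F (\<lambda>y. ereal a * f y + ereal b) \<le> ereal a * t + ereal b"
proof (cases "a = 0")
  case False
  have "ereal a * s + ereal b < ereal c \<longleftrightarrow> s < ereal ((c - b) / a)" for s c
    using assms(2) False by (cases s) (auto simp: field_simps)
  then show ?thesis
    using assms(1) unfolding Limsup_le_ereal_iff by simp
qed (auto simp: Limsup_le_iff simp flip: zero_ereal_def)

section \<open>Affine images of means over a probability space\<close>

text \<open>
  As \<open>\<infinity> - \<infinity> = \<infinity>\<close> in \<^typ>\<open>ereal\<close>, a function whose positive part has infinite integral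
  has mean \<open>\<infinity>\<close> here, just as for \<^const>\<open>sphere_mean\<close>; lower bounds for the mean therefore
  hold in this case as well.
\<close>
definition (in prob_space) ereal_mean :: "('a \<Rightarrow> ereal) \<Rightarrow> ereal" where
  "ereal_mean f = enn2ereal (\<integral>\<^sup>+x. e2ennreal (f x) \<partial>M) - enn2ereal (\<integral>\<^sup>+x. e2ennreal (- f x) \<partial>M)"

text \<open>
  The positive minus the negative part of \<open>a t + b\<close> is the corresponding combination of the parts
  of \<open>t\<close> and \<open>b\<close>. Rearranged so that no subtraction occurs, this can be integrated in
  \<^typ>\<open>ennreal\<close>.
\<close>
lemma pos_neg_affine:
  fixes t :: ereal
  assumes "0 < a" "t \<noteq> \<infinity>"
  shows "e2ennreal (ereal a * t + ereal b) + ennreal a * e2ennreal (- t) + ennreal (- b)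
      = e2ennreal (- (ereal a * t + ereal b)) + ennreal a * e2ennreal t + ennreal b"
proof (cases t)
  case (real x)
  have pos: "ennreal y = ennreal (max 0 y)" for y
    by (simp add: max_def ennreal_neg)
  have "max 0 (a * x + b) + a * max 0 (- x) + max 0 (- b)
      = max 0 (- (a * x + b)) + a * max 0 x + max 0 b"
    using assms by (cases "0 \<le> x") (auto simp: max_def mult_le_0_iff zero_le_mult_iff)
  then have "ennreal (max 0 (a * x + b) + a * max 0 (- x) + max 0 (- b))
      = ennreal (max 0 (- (a * x + b)) + a * max 0 x + max 0 b)"
    by simp
  then show ?thesis
    using assms real unfolding ereal_uminus_eq_reorder
    by (simp add: ennreal_plus ennreal_mult flip: pos)
qed (use assms in \<open>auto simp: ennreal_mult_eq_top_iff\<close>)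

lemma pos_affine_le:
  fixes t :: ereal
  assumes "0 < a" "t \<noteq> \<infinity>"
  shows "e2ennreal (ereal a * t + ereal b) \<le> ennreal a * e2ennreal t + ennreal b"
    and "ennreal a * e2ennreal t \<le> e2ennreal (ereal a * t + ereal b) + ennreal (- b)"
proof -
  have pos: "ennreal y = ennreal (max 0 y)" for y
    by (simp add: max_def ennreal_neg)
  have sc: "ennreal a * ennreal x = ennreal (max 0 (a * x))" for x
    using assms by (simp add: max_def ennreal_neg mult_le_0_iff zero_le_mult_iff flip: ennreal_mult')
  note [simp] = sc pos[symmetric]
  show "e2ennreal (ereal a * t + ereal b) \<le> ennreal a * e2ennreal t + ennreal b"
  proof (cases t)
    case (real x)
    have "ennreal (max 0 (a * x + b)) \<le> ennreal (max 0 (a * x) + max 0 b)"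
      by (rule ennreal_leI) auto
    with real show ?thesis by (simp add: ennreal_plus)
  qed (use assms in \<open>auto simp: e2ennreal_neg\<close>)
  show "ennreal a * e2ennreal t \<le> e2ennreal (ereal a * t + ereal b) + ennreal (- b)"
  proof (cases t)
    case (real x)
    have "ennreal (max 0 (a * x)) \<le> ennreal (max 0 (a * x + b) + max 0 (- b))"
      by (rule ennreal_leI) auto
    with real show ?thesis by (simp add: ennreal_plus)
  qed (use assms in \<open>auto simp: e2ennreal_neg\<close>)
qed

text \<open>
  When \<open>f\<close> has finite integrals of both parts, this is linearity of the integral; the point is
  that the infinite cases are consistent. The value \<open>t = -\<infinity>\<close> makes the left side \<open>-\<infinity>\<close>
  unless \<open>a = 0\<close>, and otherwise \<open>t\<close> is real, so that an infinite negative part forces the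
  positive part to be infinite as well; the positive part of the affine image then inherits this.
\<close>
lemma (in prob_space) le_ereal_mean_affine:
  assumes f [measurable]: "f \<in> borel_measurable M" and fin: "\<And>x. f x \<noteq> \<infinity>"
    and a: "0 \<le> a" and t: "t \<le> ereal_mean f" "t \<noteq> \<infinity>"
  shows "ereal a * t + ereal b \<le> ereal_mean (\<lambda>x. ereal a * f x + ereal b)"
proof (cases "a = 0 \<or> t = -\<infinity>")
  case True
  then show ?thesis
  proof
    assume "a = 0"
    then show ?thesis
      unfolding ereal_mean_def
      by (cases "0 \<le> b") (simp_all add: emeasure_space_1 ennreal_neg enn2ereal_ennreal zero_ennreal.rep_eq flip: zero_ereal_def)
  next
    assume "t = -\<infinity>"
    then show ?thesis
      using a by (cases "a = 0") (cases "0 \<le> b", simp_all add: ereal_mean_def emeasure_space_1 ennreal_neg enn2ereal_ennreal zero_ennreal.rep_eq flip: zero_ereal_def)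
  qed
next
  case False
  then have a: "0 < a" and "t \<noteq> -\<infinity>" using a by auto
  then obtain s where s: "t = ereal s" using t by (cases t) auto
  define P N P' N' where
    "P = (\<integral>\<^sup>+x. e2ennreal (f x) \<partial>M)" and "N = (\<integral>\<^sup>+x. e2ennreal (- f x) \<partial>M)" and
    "P' = (\<integral>\<^sup>+x. e2ennreal (ereal a * f x + ereal b) \<partial>M)" and
    "N' = (\<integral>\<^sup>+x. e2ennreal (- (ereal a * f x + ereal b)) \<partial>M)"
  note defs = P_def N_def P'_def N'_def
  have "(\<integral>\<^sup>+x. e2ennreal (ereal a * f x + ereal b) + ennreal a * e2ennreal (- f x) + ennreal (- b) \<partial>M)
      = (\<integral>\<^sup>+x. e2ennreal (- (ereal a * f x + ereal b)) + ennreal a * e2ennreal (f x) + ennreal b \<partial>M)"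
    by (intro nn_integral_cong pos_neg_affine a fin)
  then have eq: "P' + ennreal a * N + ennreal (- b) = N' + ennreal a * P + ennreal b"
    unfolding defs by (simp add: nn_integral_add nn_integral_cmult emeasure_space_1)
  have "P' \<le> (\<integral>\<^sup>+x. ennreal a * e2ennreal (f x) + ennreal b \<partial>M)"
    unfolding defs by (intro nn_integral_mono pos_affine_le a fin)
  then have P': "P' \<le> ennreal a * P + ennreal b"
    unfolding defs by (simp add: nn_integral_add nn_integral_cmult emeasure_space_1)
  have "(\<integral>\<^sup>+x. ennreal a * e2ennreal (f x) \<partial>M)
      \<le> (\<integral>\<^sup>+x. e2ennreal (ereal a * f x + ereal b) + ennreal (- b) \<partial>M)"
    by (intro nn_integral_mono pos_affine_le a fin)
  then have P: "ennreal a * P \<le> P' + ennreal (- b)"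
    unfolding defs by (simp add: nn_integral_add nn_integral_cmult emeasure_space_1)
  have t': "ereal s \<le> enn2ereal P - enn2ereal N"
    using t s unfolding ereal_mean_def defs by simp
  have "ereal (a * s + b) \<le> enn2ereal P' - enn2ereal N'"
  proof (cases "P = \<infinity>")
    case True
    then have "P' = \<infinity>"
      using P a by (auto simp: ennreal_mult_eq_top_iff ennreal_mult_top top_unique)
    then show ?thesis by simp
  next
    case False
    then obtain p where p: "P = ennreal p" "0 \<le> p" by (cases P) auto
    have "N \<noteq> \<infinity>"
      using t' p by auto
    then obtain n where n: "N = ennreal n" "0 \<le> n" by (cases N) auto
    have "P' \<noteq> \<infinity>"
      using P' p by (auto simp: ennreal_mult_eq_top_iff top_unique)
    then obtain p' where p': "P' = ennreal p'" "0 \<le> p'" by (cases P') auto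
    have "N' \<noteq> \<infinity>"
      using eq p n p' by (auto simp: ennreal_mult_eq_top_iff)
    then obtain n' where n': "N' = ennreal n'" "0 \<le> n'" by (cases N') auto
    have pos: "ennreal y = ennreal (max 0 y)" for y
      by (simp add: max_def ennreal_neg)
    have "ennreal (p' + a * n + max 0 (- b)) = ennreal (n' + a * p + max 0 b)"
      using eq a p n p' n' by (simp add: ennreal_plus ennreal_mult flip: pos)
    then have "p' + a * n + max 0 (- b) = n' + a * p + max 0 b"
      using a p n p' n' by (subst (asm) ennreal_inj) auto
    then have "p' - n' = a * (p - n) + b"
      by (auto simp: algebra_simps max_def split: if_splits)
    moreover have "a * s \<le> a * (p - n)"
      using t' p n a by (simp add: enn2ereal_ennreal)
    ultimately show ?thesis
      using p' n' by (simp add: enn2ereal_ennreal)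
  qed
  then show ?thesis
    unfolding ereal_mean_def s defs by simp
qed

section \<open>Spherical means\<close>

lemma AE_sphere_prob:
  fixes x :: "'a::euclidean_space"
  assumes "0 \<le> r"
  shows "AE y in sphere_prob x r. y \<in> sphere x r"
  unfolding sphere_prob_def
proof (subst AE_distr_iff)
  show "AE z in uniform_measure lborel (cball 0 1). x + r *\<^sub>R sgn z \<in> sphere x r"
  proof (rule AE_uniform_measureI)
    show "AE z in lborel. z \<in> cball 0 1 \<longrightarrow> x + r *\<^sub>R sgn z \<in> sphere x r"
      using AE_lborel_singleton[of "0 :: 'a"]
      by eventually_elim (use assms in \<open>auto simp: dist_norm norm_sgn\<close>)
  qed simp
qed (auto simp: sgn_div_norm pred_def)

lemma prob_space_sphere_prob: "prob_space (sphere_prob (x :: 'a::euclidean_space) r)"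
  unfolding sphere_prob_def
proof (rule prob_space.prob_space_distr[OF prob_space_uniform_measure])
  show "emeasure lborel (cball (0::'a) 1) \<noteq> 0"
    using content_cball_pos[of 1 "0::'a"] by (auto simp: measure_def)
  show "emeasure lborel (cball (0::'a) 1) \<noteq> \<infinity>"
    using emeasure_lborel_cball_finite[of "0::'a" 1] by auto
  show "(\<lambda>z::'a. x + r *\<^sub>R sgn z) \<in> uniform_measure lborel (cball 0 1) \<rightarrow>\<^sub>M borel"
    by (simp add: sgn_div_norm)
qed

lemma sphere_mean_eq:
  assumes "0 \<le> r"
  shows "sphere_mean u x r = enn2ereal (\<integral>\<^sup>+y. e2ennreal (u y) \<partial>sphere_prob x r)
     - enn2ereal (\<integral>\<^sup>+y. e2ennreal (- u y) \<partial>sphere_prob x r)"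
proof -
  have "(\<integral>\<^sup>+y\<in>sphere x r. f y \<partial>sphere_prob x r) = (\<integral>\<^sup>+y. f y \<partial>sphere_prob x r)" for f
    by (rule nn_integral_cong_AE, use AE_sphere_prob[OF assms, of x] in eventually_elim) auto
  then show ?thesis
    unfolding sphere_mean_def by simp
qed

lemma sphere_mean_mono:
  assumes "\<And>y. y \<in> sphere x r \<Longrightarrow> u y \<le> w y"
  shows "sphere_mean u x r \<le> sphere_mean w x r"
  unfolding sphere_mean_def
  by (intro ereal_minus_mono less_eq_ennreal.rep_eq[THEN iffD1] nn_integral_mono)
     (auto simp: indicator_def intro!: e2ennreal_mono assms)

section \<open>Chord means and convexity\<close>

text \<open>
  Taking the infimum over all directions gives an operator of the same type as
  \<^const>\<open>sphere_mean\<close>, for which the sub-mean-value inequality is the midpoint inequality on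
  all chords centred at \<open>x\<close>. In dimension one there is only one such chord for each radius.
\<close>
definition chord_mean :: "('a::euclidean_space \<Rightarrow> ereal) \<Rightarrow> 'a \<Rightarrow> real \<Rightarrow> ereal" where
  "chord_mean u x r = (INF h\<in>sphere 0 r. ereal (1/2) * u (x - h) + ereal (1/2) * u (x + h))"

lemma chord_mean_mono:
  assumes "\<And>y. y \<in> sphere x r \<Longrightarrow> u y \<le> w y"
  shows "chord_mean u x r \<le> chord_mean w x r"
  unfolding chord_mean_def
  by (intro INF_mono' INF_superset_mono order_refl add_mono ereal_mult_left_mono assms) (auto simp: dist_norm)

definition submean_on ::
    "(('a \<Rightarrow> ereal) \<Rightarrow> 'a \<Rightarrow> real \<Rightarrow> ereal) \<Rightarrow> 'a::euclidean_space set \<Rightarrow> ('a \<Rightarrow> ereal) \<Rightarrow> bool" where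
  "submean_on A S u \<longleftrightarrow>
     (\<forall>x\<in>S. \<exists>\<rho>>0. ball x \<rho> \<subseteq> S \<and> (\<forall>r. 0 < r \<and> r < \<rho> \<longrightarrow> u x \<le> A u x r))"

text \<open>
  If the maximum were positive, it would be attained at an interior point, and at the leftmost such
  point the midpoint inequality fails, since one of the two averaged values is strictly smaller.
\<close>
lemma chord_maximum_principle:
  fixes f :: "real \<Rightarrow> ereal"
  assumes usc: "usc_on {0..1} f"
    and fin: "\<And>s. s \<in> {0..1} \<Longrightarrow> f s \<noteq> \<infinity>"
    and ends: "f 0 \<le> 0" "f 1 \<le> 0"
    and mid: "\<And>s. s \<in> {0<..<1} \<Longrightarrow>
      \<exists>\<delta>0>0. \<forall>\<delta>. 0 < \<delta> \<and> \<delta> < \<delta>0 \<longrightarrow> f s \<le> ereal (1/2) * f (s - \<delta>) + ereal (1/2) * f (s + \<delta>)"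
    and t: "t \<in> {0..1}"
  shows "f t \<le> 0"
proof (rule ccontr)
  assume neg: "\<not> f t \<le> 0"
  have "\<exists>m\<in>{0..1}. \<forall>s\<in>{0..1}. f s \<le> f m"
    using usc by (intro usc_attains_sup) auto
  then obtain m where m: "m \<in> {0..1}" "\<And>s. s \<in> {0..1} \<Longrightarrow> f s \<le> f m"
    by blast
  have "f m > 0"
    using neg m(2)[OF t] by auto
  define Z where "Z = {s\<in>{0..1}. f m \<le> f s}"
  have "compact Z"
    unfolding Z_def by (rule usc_compact_superlevel) (use usc in auto)
  moreover have "Z \<noteq> {}" using m by (auto simp: Z_def)
  ultimately obtain s where s: "s \<in> Z" "\<And>s'. s' \<in> Z \<Longrightarrow> s \<le> s'"
    using compact_attains_inf[of Z] by blast
  have fs: "f s = f m" and s01: "s \<in> {0..1}" using s m by (auto simp: Z_def antisym)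
  have "s \<noteq> 0" "s \<noteq> 1" using ends \<open>f m > 0\<close> fs by auto
  then have s_in: "s \<in> {0<..<1}" using s01 by auto
  from mid[OF this] obtain \<delta>0 where d0: "\<delta>0 > 0"
    "\<And>\<delta>. 0 < \<delta> \<Longrightarrow> \<delta> < \<delta>0 \<Longrightarrow> f s \<le> ereal (1/2) * f (s - \<delta>) + ereal (1/2) * f (s + \<delta>)"
    by auto
  define \<delta> where "\<delta> = min (\<delta>0 / 2) (min s (1 - s))"
  have d: "0 < \<delta>" "\<delta> < \<delta>0" "s - \<delta> \<in> {0..1}" "s + \<delta> \<in> {0..1}"
    using d0(1) s_in unfolding \<delta>_def greaterThanLessThan_iff atLeastAtMost_iff by linarith+
  have "f (s - \<delta>) < f m"
    using s(2)[of "s - \<delta>"] d by (force simp: Z_def)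
  moreover have "f (s + \<delta>) \<le> f m" "f m \<noteq> \<infinity>"
    using m(2) d fin m(1) by auto
  moreover have "f m \<le> ereal (1/2) * f (s - \<delta>) + ereal (1/2) * f (s + \<delta>)"
    using d0(2)[OF d(1,2)] fs by simp
  ultimately show False
    using \<open>f m > 0\<close> by (cases "f m"; cases "f (s - \<delta>)"; cases "f (s + \<delta>)") auto
qed

text \<open>
  The maximum principle is applied on the segment to the difference of \<open>u\<close> and an affine function
  that lies above \<open>u\<close> at the two endpoints.
\<close>
lemma chord_submean_imp_convex:
  fixes u :: "'a::euclidean_space \<Rightarrow> ereal"
  assumes S: "open S" and fin: "\<And>x. x \<in> S \<Longrightarrow> u x \<noteq> \<infinity>"
    and usc: "usc_on S u" and sub: "submean_on chord_mean S u"
    and seg: "closed_segment y z \<subseteq> S" and t: "t \<in> {0..1}"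
  shows "u ((1 - t) *\<^sub>R y + t *\<^sub>R z) \<le> ereal (1 - t) * u y + ereal t * u z"
proof (cases "y = z \<or> t = 0 \<or> t = 1")
  case True
  moreover have "u z = ereal (1 - t) * u z + ereal t * u z"
    using fin[of z] seg t by (cases "u z"; cases "t = 0"; cases "t = 1") (auto simp: algebra_simps simp flip: zero_ereal_def)
  ultimately show ?thesis
    by (auto simp flip: zero_ereal_def one_ereal_def scaleR_add_left)
next
  case False
  define p where "p = (\<lambda>s::real. (1 - s) *\<^sub>R y + s *\<^sub>R z)"
  have pS: "p s \<in> S" if "s \<in> {0..1}" for s
    using seg that by (auto simp: p_def closed_segment_def)
  (* A value of -\<infinity> at an endpoint leaves no chord to compare with, so chords through real
     numbers above the endpoint values are used, and optimised at the end. *)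
  have le: "u (p t) \<le> ereal ((1 - t) * \<alpha> + t * \<beta>)" if ab: "u y \<le> ereal \<alpha>" "u z \<le> ereal \<beta>" for \<alpha> \<beta>
  proof -
    define l where "l = (\<lambda>s::real. (1 - s) * \<alpha> + s * \<beta>)"
    have less_iff: "v - ereal c < ereal a \<longleftrightarrow> v < ereal (a + c)" for v a c
      by (cases v) auto
    have "u (p t) - ereal (l t) \<le> 0"
    proof (rule chord_maximum_principle[OF _ _ _ _ _ t])
      show "usc_on {0..1} (\<lambda>s. u (p s) - ereal (l s))"
        unfolding usc_on_def Limsup_le_ereal_iff
      proof (intro ballI allI impI)
        fix s a assume s: "s \<in> {0..1}" and "u (p s) - ereal (l s) < ereal a"
        then have "u (p s) < ereal (a + l s)" by (simp add: less_iff)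
        then obtain q where q: "u (p s) < ereal q" "q < a + l s"
          using ereal_dense2 by (metis less_ereal.simps(1))
        have "\<forall>\<^sub>F x in nhds (p s). u x < ereal q"
          using usc pS[OF s] q(1) unfolding usc_on_open_iff[OF S] by blast
        moreover have "filterlim p (nhds (p s)) (nhds s)"
          unfolding p_def by (intro tendsto_intros filterlim_ident)
        ultimately have "\<forall>\<^sub>F s' in nhds s. u (p s') < ereal q"
          unfolding filterlim_iff by blast
        moreover have "((\<lambda>s'. a + l s') \<longlongrightarrow> a + l s) (nhds s)"
          unfolding l_def by (intro tendsto_intros filterlim_ident)
        then have "\<forall>\<^sub>F s' in nhds s. q < a + l s'"
          using q(2) by (rule order_tendstoD)
        ultimately have "\<forall>\<^sub>F s' in nhds s. u (p s') - ereal (l s') < ereal a"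
        proof eventually_elim
          case (elim s')
          then have "u (p s') < ereal (a + l s')" by (meson less_ereal.simps(1) less_trans)
          then show ?case by (simp add: less_iff)
        qed
        then show "\<forall>\<^sub>F s' in at s within {0..1}. u (p s') - ereal (l s') < ereal a"
          by (simp add: eventually_at_filter eventually_mono)
      qed
    next
      fix s :: real assume "s \<in> {0..1}"
      then show "u (p s) - ereal (l s) \<noteq> \<infinity>"
        using fin[OF pS] by (cases "u (p s)") auto
    next
      show "u (p 0) - ereal (l 0) \<le> 0" "u (p 1) - ereal (l 1) \<le> 0"
        using ab by (auto simp: p_def l_def ereal_minus_le_iff)
    next
      fix s :: real assume s: "s \<in> {0<..<1}"
      then have "p s \<in> S" using pS by auto
      then obtain \<rho> where \<rho>: "\<rho> > 0" "\<And>r. 0 < r \<Longrightarrow> r < \<rho> \<Longrightarrow> u (p s) \<le> chord_mean u (p s) r"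
        using sub unfolding submean_on_def by blast
      have n: "norm (z - y) > 0" using False by auto
      have "u (p s) - ereal (l s)
          \<le> ereal (1/2) * (u (p (s - \<delta>)) - ereal (l (s - \<delta>))) + ereal (1/2) * (u (p (s + \<delta>)) - ereal (l (s + \<delta>)))"
        if \<delta>: "0 < \<delta>" "\<delta> < \<rho> / norm (z - y)" for \<delta>
      proof -
        define h where "h = \<delta> *\<^sub>R (z - y)"
        have ph: "p (s - \<delta>) = p s - h" "p (s + \<delta>) = p s + h"
          by (auto simp: p_def h_def algebra_simps)
        have "0 < norm h" "norm h < \<rho>"
          using \<delta> n unfolding h_def norm_scaleR by (auto simp: pos_less_divide_eq)
        then have "u (p s) \<le> chord_mean u (p s) (norm h)"
          by (rule \<rho>(2))
        also have "\<dots> \<le> ereal (1/2) * u (p s - h) + ereal (1/2) * u (p s + h)"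
          unfolding chord_mean_def by (rule INF_lower) auto
        finally have "u (p s) \<le> ereal (1/2) * u (p s - h) + ereal (1/2) * u (p s + h)" .
        then show ?thesis
          unfolding ph by (cases "u (p s)"; cases "u (p s - h)"; cases "u (p s + h)")
            (auto simp: l_def field_simps)
      qed
      then show "\<exists>\<delta>0>0. \<forall>\<delta>. 0 < \<delta> \<and> \<delta> < \<delta>0 \<longrightarrow> u (p s) - ereal (l s)
          \<le> ereal (1/2) * (u (p (s - \<delta>)) - ereal (l (s - \<delta>))) + ereal (1/2) * (u (p (s + \<delta>)) - ereal (l (s + \<delta>)))"
        using n \<rho>(1) by (intro exI[of _ "\<rho> / norm (z - y)"]) auto
    qed
    then show ?thesis
      unfolding l_def by (cases "u (p t)") auto
  qed
  have t': "0 < t" "t < 1" using False t by auto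
  have yz: "u y \<noteq> \<infinity>" "u z \<noteq> \<infinity>" using fin seg by auto
  have "u (p t) \<le> ereal (1 - t) * u y + ereal t * u z"
  proof (rule ereal_le_real)
    fix c assume "ereal (1 - t) * u y + ereal t * u z \<le> ereal c"
    then obtain \<alpha> \<beta> where "u y \<le> ereal \<alpha>" "u z \<le> ereal \<beta>" "(1 - t) * \<alpha> + t * \<beta> \<le> c"
    proof (cases "u y")
      case (real \<alpha>)
      show ?thesis
      proof (cases "u z")
        case (real \<beta>)
        with \<open>u y = _\<close> show ?thesis using that[of \<alpha> \<beta>] \<open>_ \<le> ereal c\<close> by auto
      next
        case MInf
        with \<open>u y = _\<close> show ?thesis using that[of \<alpha> "(c - (1 - t) * \<alpha>) / t"] t' by auto
      qed (use yz in auto)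
    next
      case MInf
      obtain \<beta> where "u z \<le> ereal \<beta>" using yz by (cases "u z") auto
      with MInf show ?thesis using that[of "(c - t * \<beta>) / (1 - t)" \<beta>] t' by auto
    qed (use yz in auto)
    then show "u (p t) \<le> ereal c"
      using le[of \<alpha> \<beta>] by (meson dual_order.trans ereal_less_eq(3))
  qed
  then show ?thesis unfolding p_def .
qed

lemma chord_submean_imp_locally_convex:
  assumes "open S" "\<And>x. x \<in> S \<Longrightarrow> u x \<noteq> \<infinity>" "usc_on S u" "submean_on chord_mean S u"
  shows "locally_convex_on S u"
  unfolding locally_convex_on_def
proof
  fix x assume "x \<in> S"
  then obtain \<rho> where \<rho>: "\<rho> > 0" "ball x \<rho> \<subseteq> S"
    using \<open>open S\<close> open_contains_ball by blast
  have "closed_segment y z \<subseteq> S" if "y \<in> ball x \<rho>" "z \<in> ball x \<rho>" for y z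
    using that \<rho>(2) closed_segment_subset[OF that convex_ball] by blast
  then show "\<exists>\<rho>>0. ball x \<rho> \<subseteq> S \<and> (\<forall>y\<in>ball x \<rho>. \<forall>z\<in>ball x \<rho>. \<forall>t\<in>{0..1}.
           u ((1 - t) *\<^sub>R y + t *\<^sub>R z) \<le> ereal (1 - t) * u y + ereal t * u z)"
    using \<rho> chord_submean_imp_convex[OF assms] by blast
qed

lemma locally_convex_imp_chord_submean:
  assumes "locally_convex_on S u"
  shows "submean_on chord_mean S u"
  unfolding submean_on_def
proof
  fix x assume "x \<in> S"
  then obtain \<rho> where \<rho>: "\<rho> > 0" "ball x \<rho> \<subseteq> S"
    "\<And>y z t. y \<in> ball x \<rho> \<Longrightarrow> z \<in> ball x \<rho> \<Longrightarrow> t \<in> {0..1} \<Longrightarrow>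
        u ((1 - t) *\<^sub>R y + t *\<^sub>R z) \<le> ereal (1 - t) * u y + ereal t * u z"
    using assms unfolding locally_convex_on_def by blast
  have "u x \<le> ereal (1/2) * u (x - h) + ereal (1/2) * u (x + h)" if "norm h < \<rho>" for h
    using \<rho>(3)[of "x - h" "x + h" "1/2"] that
    by (simp add: dist_norm scaleR_diff_right scaleR_add_right flip: scaleR_add_left)
  then show "\<exists>\<rho>>0. ball x \<rho> \<subseteq> S \<and> (\<forall>r. 0 < r \<and> r < \<rho> \<longrightarrow> u x \<le> chord_mean u x r)"
    using \<rho>(1,2) unfolding chord_mean_def by (auto intro!: exI[of _ \<rho>] INF_greatest)
qed

text \<open>
  In dimension one, every \<open>y\<close> near \<open>x\<close> lies on a chord from \<open>x\<close> to one of the two points at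
  distance \<open>r\<close>, so that \<open>u y\<close> is bounded by an affine interpolation that tends to \<open>u x\<close>.
\<close>
lemma locally_convex_imp_usc:
  fixes u :: "'a::euclidean_space \<Rightarrow> ereal"
  assumes dim: "DIM('a) = 1" and S: "open S" and fin: "\<And>x. x \<in> S \<Longrightarrow> u x \<noteq> \<infinity>"
    and conv: "locally_convex_on S u"
  shows "usc_on S u"
  unfolding usc_on_def Limsup_le_ereal_iff
proof (intro ballI allI impI)
  fix x a assume x: "x \<in> S" and a: "u x < ereal a"
  obtain \<rho> where \<rho>: "\<rho> > 0" "ball x \<rho> \<subseteq> S"
    "\<And>y z t. y \<in> ball x \<rho> \<Longrightarrow> z \<in> ball x \<rho> \<Longrightarrow> t \<in> {0..1} \<Longrightarrow>
        u ((1 - t) *\<^sub>R y + t *\<^sub>R z) \<le> ereal (1 - t) * u y + ereal t * u z"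
    using conv x unfolding locally_convex_on_def by blast
  define r where "r = \<rho> / 2"
  have r: "0 < r" "r < \<rho>" using \<rho> by (auto simp: r_def)
  obtain e :: 'a where e: "Basis = {e}"
    using dim card_1_singletonE by blast
  have norm_e: "norm e = 1" using e by (metis insertI1 norm_Basis)
  have sph: "y - x = dist x y *\<^sub>R e \<or> y - x = - dist x y *\<^sub>R e" for y
  proof -
    have "((y - x) \<bullet> e) *\<^sub>R e = y - x"
      using euclidean_representation[of "y - x"] unfolding e by (simp del: inner_diff_left)
    then have "y - x = ((y - x) \<bullet> e) *\<^sub>R e" ..
    moreover from this have "dist x y = \<bar>(y - x) \<bullet> e\<bar>"
      using norm_e by (metis dist_commute dist_norm mult.right_neutral norm_scaleR)
    ultimately show ?thesis by (auto simp: abs_if)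
  qed
  have "x + r *\<^sub>R e \<in> S" "x - r *\<^sub>R e \<in> S"
    using \<rho>(2) r norm_e by (auto simp: subset_iff dist_norm)
  then have "max (u (x + r *\<^sub>R e)) (u (x - r *\<^sub>R e)) < \<infinity>"
    using fin by (simp add: max_def)
  then obtain C where C: "u (x + r *\<^sub>R e) \<le> ereal C" "u (x - r *\<^sub>R e) \<le> ereal C"
    by (meson ereal_dense2 less_imp_le max.bounded_iff)
  obtain c where c: "u x \<le> ereal c" "c < a"
    using ereal_dense2[OF a] by (metis less_ereal.simps(1) order_less_imp_le)
  define l where "l = (\<lambda>y. (1 - dist x y / r) * c + dist x y / r * C)"
  have "(l \<longlongrightarrow> l x) (nhds x)"
    unfolding l_def by (intro tendsto_intros filterlim_ident) (use r in auto)
  then have "\<forall>\<^sub>F y in nhds x. l y < a"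
    by (rule order_tendstoD) (use c in \<open>simp add: l_def\<close>)
  moreover have "\<forall>\<^sub>F y in nhds x. y \<in> ball x r"
    by (rule eventually_nhds_in_open) (use r in auto)
  ultimately have "\<forall>\<^sub>F y in nhds x. u y < ereal a"
  proof eventually_elim
    case (elim y)
    define t where "t = dist x y / r"
    have t: "t \<in> {0..1}" using elim r by (auto simp: t_def)
    obtain z where z: "z \<in> {x + r *\<^sub>R e, x - r *\<^sub>R e}" "y = (1 - t) *\<^sub>R x + t *\<^sub>R z"
      using sph[of y]
    proof
      assume "y - x = dist x y *\<^sub>R e"
      then show ?thesis using r that[of "x + r *\<^sub>R e"] by (simp add: t_def algebra_simps)
    next
      assume "y - x = - dist x y *\<^sub>R e"
      then show ?thesis using r that[of "x - r *\<^sub>R e"] by (simp add: t_def algebra_simps)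
    qed
    have "u y \<le> ereal (1 - t) * u x + ereal t * u z"
      unfolding z(2) using z(1) r norm_e t by (intro \<rho>(3)) (auto simp: dist_norm)
    also have "\<dots> \<le> ereal (1 - t) * ereal c + ereal t * ereal C"
      using t c C z(1) by (intro add_mono ereal_mult_left_mono) auto
    also have "\<dots> = ereal (l y)" by (simp add: l_def t_def)
    also have "\<dots> < ereal a" using elim by simp
    finally show ?case .
  qed
  then show "\<forall>\<^sub>F y in at x within S. u y < ereal a"
    by (simp add: eventually_at_filter eventually_mono)
qed

section \<open>A uniform description of subharmonic functions\<close>

definition mean_op :: "('a::euclidean_space \<Rightarrow> ereal) \<Rightarrow> 'a \<Rightarrow> real \<Rightarrow> ereal" where
  "mean_op = (if DIM('a) = 1 then chord_mean else sphere_mean)"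

lemma mean_op_mono:
  assumes "\<And>y. y \<in> sphere x r \<Longrightarrow> u y \<le> w y"
  shows "mean_op u x r \<le> mean_op w x r"
  unfolding mean_op_def by (auto intro!: sphere_mean_mono chord_mean_mono assms)

text \<open>
  This removes the case distinction on the dimension from everything that uses only the
  monotonicity of the mean.
\<close>
lemma subharmonic_on_iff_mean:
  fixes u :: "'a::euclidean_space \<Rightarrow> ereal"
  assumes "open S"
  shows "subharmonic_on S u \<longleftrightarrow>
    (\<forall>x\<in>S. u x \<noteq> \<infinity>) \<and> usc_on S u \<and> submean_on mean_op S u"
proof (cases "DIM('a) = 1")
  case True
  then show ?thesis
    using locally_convex_imp_usc[OF True assms] locally_convex_imp_chord_submean[of S u]
      chord_submean_imp_locally_convex[OF assms]
    unfolding subharmonic_on_def mean_op_def by auto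
next
  case False
  then show ?thesis
    unfolding subharmonic_on_def mean_op_def submean_on_def locally_submean_on_def by simp
qed

text \<open>
  For spheres, upper semicontinuity enters through the measurability that linearity of the
  integral requires.
\<close>
lemma mean_op_affine:
  fixes u :: "'a::euclidean_space \<Rightarrow> ereal"
  assumes S: "open S" and fin: "\<And>y. y \<in> S \<Longrightarrow> u y \<noteq> \<infinity>" and usc: "usc_on S u"
    and r: "0 < r" "cball x r \<subseteq> S" and a: "0 \<le> a"
    and le: "u x \<le> mean_op u x r"
  shows "ereal a * u x + ereal b \<le> mean_op (\<lambda>y. ereal a * u y + ereal b) x r"
proof (cases "DIM('a) = 1")
  case True
  show ?thesis
    unfolding mean_op_def if_P[OF True] chord_mean_def
  proof (rule INF_greatest)
    fix h :: 'a assume h: "h \<in> sphere 0 r"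
    have "u x \<le> ereal (1/2) * u (x - h) + ereal (1/2) * u (x + h)"
      using le h unfolding mean_op_def if_P[OF True] chord_mean_def by (simp add: le_INF_iff)
    then have "ereal a * u x + ereal b
        \<le> ereal a * (ereal (1/2) * u (x - h) + ereal (1/2) * u (x + h)) + ereal b"
      using a by (intro add_right_mono ereal_mult_left_mono) auto
    also have "u (x - h) \<noteq> \<infinity>" "u (x + h) \<noteq> \<infinity>"
      using h r fin by (auto simp: dist_norm subset_iff)
    then have "ereal a * (ereal (1/2) * u (x - h) + ereal (1/2) * u (x + h)) + ereal b
        = ereal (1/2) * (ereal a * u (x - h) + ereal b) + ereal (1/2) * (ereal a * u (x + h) + ereal b)"
      using a by (cases "a = 0"; cases "u (x - h)"; cases "u (x + h)")
         (auto simp: field_simps simp flip: zero_ereal_def)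
    finally show "ereal a * u x + ereal b
        \<le> ereal (1/2) * (ereal a * u (x - h) + ereal b) + ereal (1/2) * (ereal a * u (x + h) + ereal b)" .
  qed
next
  case False
  interpret prob_space "sphere_prob x r" by (rule prob_space_sphere_prob)
  have mean: "sphere_mean f x r = ereal_mean f" for f
    unfolding ereal_mean_def by (rule sphere_mean_eq) (use r in simp)
  define f where "f = (\<lambda>y. if y \<in> sphere x r then u y else 0)"
  have sub: "sphere x r \<subseteq> S" using r(2) by auto
  have "f \<in> borel_measurable borel"
    unfolding f_def by (rule usc_on_borel[OF S usc _ sub]) simp
  then have "f \<in> borel_measurable (sphere_prob x r)"
    by (simp add: sphere_prob_def)
  moreover have "u x \<le> ereal_mean f"
    using le False sphere_mean_mono[of x r u f] unfolding mean_op_def mean[symmetric]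
    by (auto simp: f_def)
  moreover have "x \<in> S" using r by auto
  ultimately have "ereal a * u x + ereal b \<le> ereal_mean (\<lambda>y. ereal a * f y + ereal b)"
    using fin sub r a by (intro le_ereal_mean_affine) (auto simp: f_def)
  also have "\<dots> \<le> sphere_mean (\<lambda>y. ereal a * u y + ereal b) x r"
    unfolding mean[symmetric] by (rule sphere_mean_mono) (simp add: f_def)
  finally show ?thesis using False by (simp add: mean_op_def)
qed

lemma subharmonic_on_affine:
  fixes u w :: "'a::euclidean_space \<Rightarrow> ereal"
  assumes S: "open S" and u: "subharmonic_on S u" and a: "0 \<le> a"
    and w: "\<And>x. x \<in> S \<Longrightarrow> w x = ereal a * u x + ereal b"
  shows "subharmonic_on S w"
proof -
  have fin: "\<And>x. x \<in> S \<Longrightarrow> u x \<noteq> \<infinity>" and usc: "usc_on S u" and sub: "submean_on mean_op S u"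
    using u unfolding subharmonic_on_iff_mean[OF S] by auto
  have "w x \<noteq> \<infinity>" if "x \<in> S" for x
    using fin[OF that] w[OF that] a by (cases "u x"; cases "a = 0") (auto simp flip: zero_ereal_def)
  moreover have "usc_on S w"
    unfolding usc_on_def
  proof
    fix x assume x: "x \<in> S"
    have "Limsup (at x within S) w \<le> Limsup (at x within S) (\<lambda>y. ereal a * u y + ereal b)"
      by (rule Limsup_mono) (simp add: eventually_at_filter w)
    also have "\<dots> \<le> ereal a * u x + ereal b"
      using usc x a unfolding usc_on_def by (intro Limsup_affine_le) auto
    finally show "Limsup (at x within S) w \<le> w x" using w[OF x] by simp
  qed
  moreover have "submean_on mean_op S w"
    unfolding submean_on_def
  proof
    fix x assume x: "x \<in> S"
    then obtain \<rho> where \<rho>: "\<rho> > 0" "ball x \<rho> \<subseteq> S" "\<And>r. 0 < r \<Longrightarrow> r < \<rho> \<Longrightarrow> u x \<le> mean_op u x r"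
      using sub unfolding submean_on_def by blast
    have "w x \<le> mean_op w x r" if r: "0 < r" "r < \<rho>" for r
    proof -
      have cb: "cball x r \<subseteq> S" using \<rho>(2) r by auto
      have "w x \<le> mean_op (\<lambda>y. ereal a * u y + ereal b) x r"
        unfolding w[OF x] using S fin usc r(1) cb a \<rho>(3)[OF r] by (rule mean_op_affine)
      also have "\<dots> \<le> mean_op w x r"
        by (rule mean_op_mono) (use cb w in auto)
      finally show ?thesis .
    qed
    then show "\<exists>\<rho>>0. ball x \<rho> \<subseteq> S \<and> (\<forall>r. 0 < r \<and> r < \<rho> \<longrightarrow> w x \<le> mean_op w x r)"
      using \<rho>(1,2) by blast
  qed
  ultimately show ?thesis
    unfolding subharmonic_on_iff_mean[OF S] by blast
qed

section \<open>Gluing\<close>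

text \<open>
  Near a point of \<open>U0 - U\<close> the only danger comes from points of \<open>U0 \<inter> U\<close>, where \<open>u\<close> enters.
  They accumulate at \<open>x\<close> only when \<open>x\<close> is a boundary point of \<open>U\<close>, and then the
  hypothesis on the upper limit controls \<open>u\<close>.
\<close>
lemma glue_usc_at:
  fixes u0 u V :: "'a::euclidean_space \<Rightarrow> ereal"
  assumes U0: "open U0" and usc: "usc_on U0 u0" and x: "x \<in> U0 - U"
    and bd: "x \<in> frontier U \<Longrightarrow> Limsup (at x within U0 \<inter> U) u \<le> u0 x"
    and V: "\<And>y. y \<in> U0 - U \<Longrightarrow> V y = u0 y" "\<And>y. y \<in> U0 \<inter> U \<Longrightarrow> V y = sup (u0 y) (u y)"
    and a: "u0 x < a"
  shows "\<forall>\<^sub>F y in nhds x. V y < a"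
proof -
  have "\<forall>\<^sub>F y in nhds x. u0 y < a"
    using usc x a unfolding usc_on_open_iff[OF U0] by blast
  moreover have "\<forall>\<^sub>F y in nhds x. y \<in> U0"
    using U0 x by (intro eventually_nhds_in_open) auto
  moreover have "\<forall>\<^sub>F y in nhds x. y \<in> U0 \<inter> U \<longrightarrow> u y < a"
  proof (cases "x \<in> frontier U")
    case True
    then have "\<forall>\<^sub>F y in at x within U0 \<inter> U. u y < a"
      using bd a unfolding Limsup_le_iff by blast
    then have "\<forall>\<^sub>F y in nhds x. y \<noteq> x \<longrightarrow> y \<in> U0 \<inter> U \<longrightarrow> u y < a"
      by (simp add: eventually_at_filter)
    then show ?thesis
      by eventually_elim (use x in auto)
  next
    case False
    then have "x \<in> - closure U"
      using x interior_subset[of U] by (auto simp: frontier_def)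
    then have "\<forall>\<^sub>F y in nhds x. y \<in> - closure U"
      by (intro eventually_nhds_in_open) auto
    then show ?thesis
      by eventually_elim (use closure_subset[of U] in auto)
  qed
  ultimately show ?thesis
    by eventually_elim (use V in \<open>metis Diff_iff Int_iff sup_ereal_def max_less_iff_conj\<close>)
qed

text \<open>
  The hypotheses are symmetric in the two functions, which halves the proof of upper
  semicontinuity. For the sub-mean-value inequality it only matters that the glued
  function lies above both functions and agrees at each point with one of them.
\<close>
lemma subharmonic_on_glue:
  fixes u0 u V :: "'a::euclidean_space \<Rightarrow> ereal"
  assumes U0: "open U0" and U: "open U"
    and u0: "subharmonic_on U0 u0" and u: "subharmonic_on U u"
    and bd0: "\<And>x. x \<in> U0 \<inter> frontier U \<Longrightarrow> Limsup (at x within U0 \<inter> U) u \<le> u0 x"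
    and bd: "\<And>x. x \<in> U \<inter> frontier U0 \<Longrightarrow> Limsup (at x within U \<inter> U0) u0 \<le> u x"
    and V: "\<And>x. x \<in> U0 - U \<Longrightarrow> V x = u0 x" "\<And>x. x \<in> U0 \<inter> U \<Longrightarrow> V x = sup (u0 x) (u x)"
      "\<And>x. x \<in> U - U0 \<Longrightarrow> V x = u x"
  shows "subharmonic_on (U0 \<union> U) V"
proof -
  have UU: "open (U0 \<union> U)" using U0 U by auto
  have fin0: "\<And>x. x \<in> U0 \<Longrightarrow> u0 x \<noteq> \<infinity>" and usc0: "usc_on U0 u0" and sub0: "submean_on mean_op U0 u0"
    using u0 unfolding subharmonic_on_iff_mean[OF U0] by auto
  have fin: "\<And>x. x \<in> U \<Longrightarrow> u x \<noteq> \<infinity>" and usc: "usc_on U u" and sub: "submean_on mean_op U u"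
    using u unfolding subharmonic_on_iff_mean[OF U] by auto
  have V_cases: "x \<in> U0 \<and> V x = u0 x \<or> x \<in> U \<and> V x = u x" if "x \<in> U0 \<union> U" for x
    using that V[of x] by (cases "x \<in> U0"; cases "x \<in> U") (auto simp: sup_ereal_def max_def)
  have V_ge: "x \<in> U0 \<Longrightarrow> u0 x \<le> V x" "x \<in> U \<Longrightarrow> u x \<le> V x" for x
    using V[of x] by (cases "x \<in> U0"; cases "x \<in> U"; simp)+
  have "V x \<noteq> \<infinity>" if "x \<in> U0 \<union> U" for x
    using V_cases[OF that] fin0 fin by metis
  moreover have "usc_on (U0 \<union> U) V"
    unfolding usc_on_open_iff[OF UU]
  proof (intro ballI allI impI)
    fix x a assume x: "x \<in> U0 \<union> U" and a: "V x < a"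
    consider "x \<in> U0 - U" | "x \<in> U - U0" | "x \<in> U0 \<inter> U" using x by blast
    then show "\<forall>\<^sub>F y in nhds x. V y < a"
    proof cases
      case 1
      show ?thesis
        by (rule glue_usc_at[OF U0 usc0 1 _ V(1,2)]) (use 1 bd0 V a in auto)
    next
      case 2
      have V': "V y = sup (u y) (u0 y)" if "y \<in> U \<inter> U0" for y
        using V(2)[of y] that by (simp add: sup.commute del: sup_ereal_def)
      show ?thesis
        by (rule glue_usc_at[OF U usc 2 _ V(3) V']) (use 2 bd V a in auto)
    next
      case 3
      have "u0 x < a" "u x < a"
        using a V_ge[of x] 3 by auto
      then have "\<forall>\<^sub>F y in nhds x. u0 y < a" "\<forall>\<^sub>F y in nhds x. u y < a"
        using usc0 usc 3 unfolding usc_on_open_iff[OF U0] usc_on_open_iff[OF U] by blast+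
      moreover have "\<forall>\<^sub>F y in nhds x. y \<in> U0 \<inter> U"
        using U0 U 3 by (intro eventually_nhds_in_open) auto
      ultimately show ?thesis
        by eventually_elim (use V(2) in \<open>auto simp: sup_ereal_def\<close>)
    qed
  qed
  moreover have "submean_on mean_op (U0 \<union> U) V"
  proof -
    have "\<exists>\<rho>>0. ball x \<rho> \<subseteq> U0 \<union> U \<and> (\<forall>r. 0 < r \<and> r < \<rho> \<longrightarrow> V x \<le> mean_op V x r)"
      if W: "W \<subseteq> U0 \<union> U" and sub: "submean_on mean_op W w" and le: "\<And>y. y \<in> W \<Longrightarrow> w y \<le> V y"
        and x: "x \<in> W" "V x = w x" for W w x
    proof -
      obtain \<rho> where \<rho>: "\<rho> > 0" "ball x \<rho> \<subseteq> W" "\<And>r. 0 < r \<Longrightarrow> r < \<rho> \<Longrightarrow> w x \<le> mean_op w x r"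
        using sub x unfolding submean_on_def by blast
      have "V x \<le> mean_op V x r" if r: "0 < r" "r < \<rho>" for r
      proof -
        have "V x \<le> mean_op w x r" using \<rho>(3)[OF r] x by simp
        also have "\<dots> \<le> mean_op V x r"
          using \<rho>(2) r by (intro mean_op_mono le) auto
        finally show ?thesis .
      qed
      then show ?thesis using \<rho>(1,2) W by blast
    qed
    from this[OF _ sub0 V_ge(1)] this[OF _ sub V_ge(2)] show ?thesis
      unfolding submean_on_def using V_cases by blast
  qed
  ultimately show ?thesis
    unfolding subharmonic_on_iff_mean[OF UU] by blast
qed

theorem mainTheorem2:
  fixes U U0 :: "(real ^ 'n) set"
    and v g v0 V :: "real ^ 'n \<Rightarrow> ereal"
    and m\<^sub>v M\<^sub>v m\<^sub>g M\<^sub>g :: real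
  assumes "open U" and "open U0"
    and "subharmonic_on U v" and "subharmonic_on U0 g"
    and "ereal m\<^sub>v \<le> (INF x\<in>U \<inter> frontier U0. v x)"
    and "(SUP x\<in>U0 \<inter> frontier U. Limsup (at x within U0 \<inter> U) v) \<le> ereal M\<^sub>v"
    and "- \<infinity> < (SUP x\<in>U \<inter> frontier U0. Limsup (at x within U \<inter> U0) g)"
    and "(SUP x\<in>U \<inter> frontier U0. Limsup (at x within U \<inter> U0) g) \<le> ereal m\<^sub>g"
    and "m\<^sub>g < M\<^sub>g"
    and "ereal M\<^sub>g \<le> (INF x\<in>U0 \<inter> frontier U. g x)"
    and "(INF x\<in>U0 \<inter> frontier U. g x) < \<infinity>"
    and "\<And>x. x \<in> U0 \<Longrightarrow>
           v0 x = ereal ((max 0 M\<^sub>v + max 0 (- m\<^sub>v)) / (M\<^sub>g - m\<^sub>g)) * (2 * g x - ereal M\<^sub>g - ereal m\<^sub>g)"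
    and "\<And>x. x \<in> U0 - U \<Longrightarrow> V x = v0 x"
    and "\<And>x. x \<in> U0 \<inter> U \<Longrightarrow> V x = sup (v0 x) (v x)"
    and "\<And>x. x \<in> U - U0 \<Longrightarrow> V x = v x"
  shows "subharmonic_on U0 v0 \<and> subharmonic_on (U0 \<union> U) V"
proof -
  define k where "k = max 0 M\<^sub>v + max 0 (- m\<^sub>v)"
  define c where "c = k / (M\<^sub>g - m\<^sub>g)"
  have c: "0 \<le> c" and ck: "c * (M\<^sub>g - m\<^sub>g) = k"
    using assms(9) by (auto simp: c_def k_def)
  have g_fin: "g x \<noteq> \<infinity>" if "x \<in> U0" for x
    using assms(4) that unfolding subharmonic_on_def by blast
  have v0: "v0 x = ereal (2 * c) * g x + ereal (- c * (M\<^sub>g + m\<^sub>g))" if "x \<in> U0" for x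
    using assms(12)[OF that] g_fin[OF that] c unfolding k_def[symmetric] c_def[symmetric]
    by (cases "g x"; cases "c = 0") (auto simp: algebra_simps simp flip: zero_ereal_def)
  have sub0: "subharmonic_on U0 v0"
    using assms(2,4) _ v0 by (rule subharmonic_on_affine) (use c in auto)
  moreover have "subharmonic_on (U0 \<union> U) V"
  proof (rule subharmonic_on_glue[OF assms(2,1) sub0 assms(3) _ _ assms(13-15)])
    fix x assume x: "x \<in> U0 \<inter> frontier U"
    have "Limsup (at x within U0 \<inter> U) v \<le> ereal M\<^sub>v"
      using assms(6) x by (simp add: SUP_le_iff)
    also have "\<dots> \<le> ereal k" by (simp add: k_def)
    also have "k = 2 * c * M\<^sub>g + - c * (M\<^sub>g + m\<^sub>g)"
      using ck by (simp add: algebra_simps)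
    also have "ereal \<dots> = ereal (2 * c) * ereal M\<^sub>g + ereal (- c * (M\<^sub>g + m\<^sub>g))"
      by simp
    also have "\<dots> \<le> v0 x"
    proof -
      have "ereal M\<^sub>g \<le> g x" using assms(10) x by (simp add: le_INF_iff)
      then show ?thesis
        using x c by (subst v0) (auto intro!: add_mono ereal_mult_left_mono simp del: times_ereal.simps plus_ereal.simps)
    qed
    finally show "Limsup (at x within U0 \<inter> U) v \<le> v0 x" .
  next
    fix x assume x: "x \<in> U \<inter> frontier U0"
    have "Limsup (at x within U \<inter> U0) v0
        \<le> Limsup (at x within U \<inter> U0) (\<lambda>y. ereal (2 * c) * g y + ereal (- c * (M\<^sub>g + m\<^sub>g)))"
      by (rule Limsup_mono) (simp add: eventually_at_filter v0)
    also have "\<dots> \<le> ereal (2 * c) * ereal m\<^sub>g + ereal (- c * (M\<^sub>g + m\<^sub>g))"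
      using assms(8) x c by (intro Limsup_affine_le) (auto simp: SUP_le_iff)
    also have "\<dots> = ereal (- k)"
      using ck by (simp add: algebra_simps)
    also have "\<dots> \<le> ereal m\<^sub>v" by (simp add: k_def)
    also have "\<dots> \<le> v x"
      using assms(5) x by (simp add: le_INF_iff)
    finally show "Limsup (at x within U \<inter> U0) v0 \<le> v x" .
  qed
  ultimately show ?thesis ..
qed

end
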